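(* For every integer $k\geq 1$ there exist a $(2k+1)$-graph $G$ and a perfect matching $F$ of $G$ such that for any $2k$ perfect matchings $F_1,\dots,F_{2k}$ of $G$ there are indices $1\leq i<j\leq 2k$ with $F\cap F_i\cap F_j\neq\emptyset$.
   Context: All graphs are finite and connected; multiple edges are allowed but loops are not. For a vertex set $X\subseteq V$, $\partial(X)$ denotes the set of edges with exactly one end in $X$; $X$ is odd if $|X|$ is odd. An $r$-graph is an $r$-regular graph $G=(V,E)$ such that $|\partial(X)|\geq r$ for every odd set $X\subseteq V$. *)

theory Defs
  imports Main
begin

text \<open>
  Undirected multigraphs: edges have an identity of their own, so parallel edges are distinct
  edges with the same set of ends.  Well-formedness requires two distinct ends per
  edge, which excludes loops.
\<close>

record ('v, 'e) multigraph =
  mverts :: "'v set"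
  medges :: "'e set"
  ends :: "'e \<Rightarrow> 'v set"

definition wf_multigraph :: "('v, 'e) multigraph \<Rightarrow> bool" where
  "wf_multigraph G \<longleftrightarrow>
     finite (mverts G) \<and> finite (medges G) \<and>
     (\<forall>e \<in> medges G. ends G e \<subseteq> mverts G \<and> card (ends G e) = 2)"

definition adj_rel :: "('v, 'e) multigraph \<Rightarrow> ('v \<times> 'v) set" where
  "adj_rel G = {(u, v). \<exists>e \<in> medges G. ends G e = {u, v}}"

definition connected_multigraph :: "('v, 'e) multigraph \<Rightarrow> bool" where
  "connected_multigraph G \<longleftrightarrow>
     mverts G \<noteq> {} \<and> (\<forall>u \<in> mverts G. \<forall>v \<in> mverts G. (u, v) \<in> (adj_rel G)\<^sup>*)"

definition mdegree :: "('v, 'e) multigraph \<Rightarrow> 'v \<Rightarrow> nat" where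
  "mdegree G v = card {e \<in> medges G. v \<in> ends G e}"

definition mregular :: "nat \<Rightarrow> ('v, 'e) multigraph \<Rightarrow> bool" where
  "mregular r G \<longleftrightarrow> (\<forall>v \<in> mverts G. mdegree G v = r)"

definition edge_boundary :: "('v, 'e) multigraph \<Rightarrow> 'v set \<Rightarrow> 'e set" where
  "edge_boundary G X = {e \<in> medges G. card (ends G e \<inter> X) = 1}"

definition r_graph :: "nat \<Rightarrow> ('v, 'e) multigraph \<Rightarrow> bool" where
  "r_graph r G \<longleftrightarrow>
     wf_multigraph G \<and> connected_multigraph G \<and> mregular r G \<and>
     (\<forall>X. X \<subseteq> mverts G \<and> odd (card X) \<longrightarrow> r \<le> card (edge_boundary G X))"

definition perfect_matching :: "('v, 'e) multigraph \<Rightarrow> 'e set \<Rightarrow> bool" where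
  "perfect_matching G M \<longleftrightarrow>
     M \<subseteq> medges G \<and> (\<forall>v \<in> mverts G. \<exists>!e. e \<in> M \<and> v \<in> ends G e)"

end

theory Submission
  imports Defs
begin

text \<open>
  Put \<open>r = 2 k + 1\<close> and let \<open>P\<close> be the Petersen graph in which each of the five spokes joining
  the outer to the inner 5-cycle is replaced by \<open>r - 2\<close> parallel edges.  A perfect matching
  of \<open>P\<close> uses an even number of the five outer edges, so \<open>P\<close> has no \<open>r\<close> pairwise disjoint
  perfect matchings, although it is an \<open>r\<close>-graph.  The graph \<open>G\<close> arises from \<open>P\<close> by expanding every
  vertex to a complete graph on \<open>r\<close> vertices, and \<open>F\<close> is the set of the edges coming from \<open>P\<close>.

  Suppose \<open>2 k\<close> perfect matchings of \<open>G\<close> are pairwise disjoint on \<open>F\<close>.  Each of them meets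
  the \<open>r\<close>-edge boundary of each of the ten complete graphs in an odd number of edges, all
  of which lie in \<open>F\<close>; since these \<open>2 k\<close> odd numbers add up to at most \<open>2 k + 1\<close>, they are all \<open>1\<close>, and
  exactly one edge of the boundary is left over.  Hence the \<open>2 k\<close> traces on \<open>F\<close> together with
  the unused part of \<open>F\<close> partition the edges of \<open>P\<close> into \<open>r\<close> perfect matchings, a contradiction.
\<close>

section \<open>Parity of edge boundaries\<close>

text \<open>Handshake count modulo 2: summing over \<open>X\<close> the number of edges of
  \<open>M\<close> at each vertex counts an edge once per end in \<open>X\<close>, so exactly the
  boundary edges contribute oddly. It is applied to perfect matchings and, for odd \<open>r\<close>,
  to the whole edge set.\<close>

lemma odd_card_boundary_iff:
  assumes wf: "wf_multigraph G" and M: "M \<subseteq> medges G" and X: "X \<subseteq> mverts G"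
    and deg: "\<And>v. v \<in> X \<Longrightarrow> odd (card {e \<in> M. v \<in> ends G e})"
  shows "odd (card (M \<inter> edge_boundary G X)) \<longleftrightarrow> odd (card X)"
proof -
  have fX: "finite X" and fM: "finite M"
    using wf M X finite_subset unfolding wf_multigraph_def by blast+
  have le2: "card (ends G e \<inter> X) \<le> 2" if "e \<in> M" for e
  proof -
    have "card (ends G e) = 2"
      using wf M that unfolding wf_multigraph_def by blast
    then show ?thesis
      by (metis Int_lower1 card.infinite card_mono zero_neq_numeral)
  qed
  have "(\<Sum>v\<in>X. card {e \<in> M. v \<in> ends G e}) = (\<Sum>v\<in>X. \<Sum>e\<in>M. if v \<in> ends G e then 1 else 0)"
    using fM by (intro sum.cong) (simp_all add: sum.If_cases Int_def)
  also have "\<dots> = (\<Sum>e\<in>M. \<Sum>v\<in>X. if v \<in> ends G e then 1 else 0)"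
    by (rule sum.swap)
  also have "\<dots> = (\<Sum>e\<in>M. card (ends G e \<inter> X))"
    using fX by (intro sum.cong) (simp_all add: sum.If_cases Int_def conj_commute)
  finally have "even (\<Sum>v\<in>X. card {e \<in> M. v \<in> ends G e}) \<longleftrightarrow> even (\<Sum>e\<in>M. card (ends G e \<inter> X))"
    by simp
  moreover have "{v \<in> X. odd (card {e \<in> M. v \<in> ends G e})} = X"
    using deg by blast
  moreover have "{e \<in> M. odd (card (ends G e \<inter> X))} = M \<inter> edge_boundary G X"
  proof -
    have "odd (card (ends G e \<inter> X)) \<longleftrightarrow> card (ends G e \<inter> X) = 1" if "e \<in> M" for e
      using le2[OF that] by (cases "card (ends G e \<inter> X) = 2") (auto elim: oddE)
    then show ?thesis
      using M unfolding edge_boundary_def by auto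
  qed
  ultimately show ?thesis
    by (simp add: even_sum_iff fX fM)
qed

lemma perfect_matching_iff_card:
  "perfect_matching G M \<longleftrightarrow>
     M \<subseteq> medges G \<and> (\<forall>v \<in> mverts G. card {e \<in> M. v \<in> ends G e} = 1)"
proof -
  have "(\<exists>!e. P e) \<longleftrightarrow> card {e. P e} = 1" for P :: "'b \<Rightarrow> bool"
    by (simp add: card_1_singleton_iff set_eq_iff Ex1_def) blast
  then show ?thesis
    unfolding perfect_matching_def by simp
qed

lemma perfect_matching_odd_boundary:
  assumes "wf_multigraph G" and "perfect_matching G M" and "X \<subseteq> mverts G" and "odd (card X)"
  shows "odd (card (M \<inter> edge_boundary G X))"
proof -
  have M: "M \<subseteq> medges G" and "\<And>v. v \<in> X \<Longrightarrow> card {e \<in> M. v \<in> ends G e} = 1"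
    using assms unfolding perfect_matching_iff_card by blast+
  then show ?thesis
    using odd_card_boundary_iff[OF assms(1) M assms(3)] assms(4) by simp
qed

section \<open>Relabelling vertices and edges\<close>

text \<open>The construction has pairs as vertices and sets of pairs as edges; relabelling moves it
  to \<open>nat\<close>. \<open>inv_into\<close> recovers the original edge when \<open>g\<close> is
  injective on the edges.\<close>

definition relabel :: "('v \<Rightarrow> 'w) \<Rightarrow> ('e \<Rightarrow> 'f) \<Rightarrow> ('v, 'e) multigraph \<Rightarrow> ('w, 'f) multigraph" where
  "relabel f g G =
     \<lparr>mverts = f ` mverts G, medges = g ` medges G,
      ends = (\<lambda>e. f ` ends G (inv_into (medges G) g e))\<rparr>"

lemma mverts_relabel [simp]: "mverts (relabel f g G) = f ` mverts G"
  and medges_relabel [simp]: "medges (relabel f g G) = g ` medges G"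
  by (simp_all add: relabel_def)

lemma ends_relabel:
  assumes "inj_on g (medges G)" and "e \<in> medges G"
  shows "ends (relabel f g G) (g e) = f ` ends G e"
  using assms by (simp add: relabel_def)

context
  fixes f :: "'v \<Rightarrow> 'w" and g :: "'e \<Rightarrow> 'f" and G :: "('v, 'e) multigraph"
  assumes wf: "wf_multigraph G" and f: "inj_on f (mverts G)" and g: "inj_on g (medges G)"
begin

lemma ends_subset: "e \<in> medges G \<Longrightarrow> ends G e \<subseteq> mverts G"
  using wf unfolding wf_multigraph_def by blast

lemma in_ends_relabel_iff:
  "e \<in> medges G \<Longrightarrow> v \<in> mverts G \<Longrightarrow> f v \<in> ends (relabel f g G) (g e) \<longleftrightarrow> v \<in> ends G e"
  using ends_subset f by (simp add: ends_relabel[OF g] inj_on_image_mem_iff)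

lemma wf_relabel: "wf_multigraph (relabel f g G)"
proof -
  have "card (f ` ends G e) = card (ends G e)" if "e \<in> medges G" for e
    using ends_subset[OF that] f by (meson card_image inj_on_subset)
  then show ?thesis
    using wf unfolding wf_multigraph_def by (auto simp: ends_relabel[OF g])
qed

lemma connected_relabel:
  assumes "connected_multigraph G"
  shows "connected_multigraph (relabel f g G)"
proof -
  have step: "(f u, f v) \<in> adj_rel (relabel f g G)" if "(u, v) \<in> adj_rel G" for u v
    using that unfolding adj_rel_def by (force simp: ends_relabel[OF g])
  have "(f u, f v) \<in> (adj_rel (relabel f g G))\<^sup>*" if "(u, v) \<in> (adj_rel G)\<^sup>*" for u v
    using that by induction (auto intro: rtrancl_into_rtrancl step)
  then show ?thesis
    using assms unfolding connected_multigraph_def by auto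
qed

lemma card_incident_relabel:
  assumes M: "M \<subseteq> medges G" and v: "v \<in> mverts G"
  shows "card {e \<in> g ` M. f v \<in> ends (relabel f g G) e} = card {e \<in> M. v \<in> ends G e}"
proof -
  have "{e \<in> g ` M. f v \<in> ends (relabel f g G) e} = g ` {e \<in> M. v \<in> ends G e}"
    using in_ends_relabel_iff M v by auto
  moreover have "inj_on g {e \<in> M. v \<in> ends G e}"
    using g by (rule inj_on_subset) (use M in auto)
  ultimately show ?thesis
    by (simp add: card_image)
qed

lemma mregular_relabel: "mregular r G \<Longrightarrow> mregular r (relabel f g G)"
  unfolding mregular_def mdegree_def by (auto simp: card_incident_relabel[OF subset_refl])

lemma card_edge_boundary_relabel:
  assumes X: "X \<subseteq> mverts G"
  shows "card (edge_boundary (relabel f g G) (f ` X)) = card (edge_boundary G X)"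
proof -
  have "card (f ` ends G e \<inter> f ` X) = card (ends G e \<inter> X)" if "e \<in> medges G" for e
  proof -
    have "f ` ends G e \<inter> f ` X = f ` (ends G e \<inter> X)"
      using inj_on_image_Int[OF f ends_subset[OF that] X] by simp
    then show ?thesis
      using X f by (metis card_image inj_on_subset Int_lower2)
  qed
  then have "edge_boundary (relabel f g G) (f ` X) = g ` edge_boundary G X"
    unfolding edge_boundary_def by (auto simp: ends_relabel[OF g])
  moreover have "inj_on g (edge_boundary G X)"
    using g by (rule inj_on_subset) (auto simp: edge_boundary_def)
  ultimately show ?thesis
    by (simp add: card_image)
qed

lemma r_graph_relabel:
  assumes "r_graph r G"
  shows "r_graph r (relabel f g G)"
proof -
  have "r \<le> card (edge_boundary (relabel f g G) Y)"
    if Y: "Y \<subseteq> f ` mverts G" "odd (card Y)" for Y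
  proof -
    obtain X where X: "X \<subseteq> mverts G" "Y = f ` X"
      using Y(1) by (auto simp: subset_image_iff)
    then have "odd (card X)"
      using Y(2) f by (metis card_image inj_on_subset)
    then show ?thesis
      using assms X card_edge_boundary_relabel unfolding r_graph_def by metis
  qed
  then show ?thesis
    using assms wf_relabel connected_relabel mregular_relabel unfolding r_graph_def by simp
qed

lemma perfect_matching_relabel_iff:
  assumes M: "M \<subseteq> medges G"
  shows "perfect_matching (relabel f g G) (g ` M) \<longleftrightarrow> perfect_matching G M"
  using M unfolding perfect_matching_iff_card
  by (auto simp: card_incident_relabel[OF M, simplified])

end

section \<open>The expanded Petersen graph\<close>

text \<open>
  Vertex \<open>(p, i)\<close> is the \<open>i\<close>-th vertex of the complete graph replacing the vertex \<open>p\<close> of the Petersen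
  graph.  Here \<open>p = j\<close> and \<open>p = 5 + j\<close> with \<open>j < 5\<close> are an outer vertex and its inner neighbour;
  outer edges join \<open>j\<close> to \<open>j + 1\<close> and inner ones \<open>5 + j\<close> to \<open>5 + (j + 2)\<close>, modulo \<open>5\<close>.  The edge leaving
  \<open>p\<close> along its 5-cycle is attached at \<open>i = 0\<close>, the one entering it at \<open>i = 1\<close>, and
  the \<open>r - 2\<close> spokes at \<open>i \<ge> 2\<close>.
\<close>

fun mate :: "nat \<times> nat \<Rightarrow> nat \<times> nat" where
  "mate (p, i) =
     (if i \<ge> 2 then ((p + 5) mod 10, i)
      else if p < 5 then (if i = 0 then ((p + 1) mod 5, 1) else ((p + 4) mod 5, 0))
      else (if i = 0 then (5 + (p + 2) mod 5, 1) else (5 + (p + 3) mod 5, 0)))"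

declare mate.simps [simp del]

lemma less_5_cases: "(j::nat) < 5 \<Longrightarrow> j = 0 \<or> j = 1 \<or> j = 2 \<or> j = 3 \<or> j = 4"
  by linarith

lemma less_10_cases:
  "(p::nat) < 10 \<Longrightarrow> p = 0 \<or> p = 1 \<or> p = 2 \<or> p = 3 \<or> p = 4 \<or> p = 5 \<or> p = 6 \<or> p = 7 \<or> p = 8 \<or> p = 9"
  by presburger

lemma mate_mate: "fst x < 10 \<Longrightarrow> mate (mate x) = x"
  by (cases x) (auto dest!: less_10_cases simp: mate.simps)

lemma fst_mate_less: "fst x < 10 \<Longrightarrow> fst (mate x) < 10"
  by (cases x) (auto dest!: less_10_cases simp: mate.simps)

lemma fst_mate_neq: "fst x < 10 \<Longrightarrow> fst (mate x) \<noteq> fst x"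
  by (cases x) (auto dest!: less_10_cases simp: mate.simps)

lemma snd_mate_less: "r \<ge> 2 \<Longrightarrow> snd x < r \<Longrightarrow> snd (mate x) < r"
  by (cases x) (auto simp: mate.simps)

definition block :: "nat \<Rightarrow> nat \<Rightarrow> (nat \<times> nat) set" where
  "block r p = {p} \<times> {..<r}"

definition clique_edges :: "nat \<Rightarrow> (nat \<times> nat) set set" where
  "clique_edges r = {{x, y} | x y p. p < 10 \<and> x \<in> block r p \<and> y \<in> block r p \<and> x \<noteq> y}"

text \<open>These are the edges inherited from the Petersen graph with multiplied spokes, that is,
  the matching \<open>F\<close>.\<close>

definition mate_edges :: "nat \<Rightarrow> (nat \<times> nat) set set" where
  "mate_edges r = (\<lambda>x. {x, mate x}) ` ({..<10} \<times> {..<r})"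

text \<open>Expansion attaches parallel spokes at different vertices, so no parallel edges remain
  and each edge can serve as its own set of ends.\<close>

definition expanded_petersen :: "nat \<Rightarrow> (nat \<times> nat, (nat \<times> nat) set) multigraph" where
  "expanded_petersen r =
     \<lparr>mverts = {..<10} \<times> {..<r}, medges = clique_edges r \<union> mate_edges r, ends = (\<lambda>e. e)\<rparr>"

lemma card_block [simp]: "card (block r p) = r"
  by (simp add: block_def)

lemma finite_block [simp]: "finite (block r p)"
  by (simp add: block_def)

lemma mverts_expanded: "mverts (expanded_petersen r) = {..<10} \<times> {..<r}"
  and medges_expanded: "medges (expanded_petersen r) = clique_edges r \<union> mate_edges r"
  and ends_expanded [simp]: "ends (expanded_petersen r) e = e"
  by (simp_all add: expanded_petersen_def)

lemma finite_mverts_expanded [simp]: "finite (mverts (expanded_petersen r))"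
  by (simp add: mverts_expanded)

lemma block_subset: "p < 10 \<Longrightarrow> block r p \<subseteq> mverts (expanded_petersen r)"
  by (auto simp: block_def mverts_expanded)

lemma mate_in_mverts:
  "r \<ge> 2 \<Longrightarrow> x \<in> mverts (expanded_petersen r) \<Longrightarrow> mate x \<in> mverts (expanded_petersen r)"
  using fst_mate_less[of x] snd_mate_less[of r x] by (simp add: mverts_expanded mem_Times_iff)

lemma mate_not_in_block: "p < 10 \<Longrightarrow> x \<in> block r p \<Longrightarrow> mate x \<notin> block r p"
  using fst_mate_neq[of x] by (auto simp: block_def)

text \<open>As \<open>mate\<close> is an involution, the edge generated by \<open>mate x\<close> is
  again the one generated by \<open>x\<close>.\<close>

lemma incident_mate_edges:
  assumes "x \<in> mverts (expanded_petersen r)"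
  shows "{e \<in> mate_edges r. x \<in> e} = {{x, mate x}}"
proof -
  have "{y, mate y} = {x, mate x}" if "y \<in> {..<10} \<times> {..<r}" "x \<in> {y, mate y}" for y
    using that mate_mate[of y] by (auto simp: insert_commute)
  then show ?thesis
    using assms unfolding mate_edges_def mverts_expanded by blast
qed

section \<open>Well-formedness, regularity and connectedness\<close>

lemma wf_expanded:
  assumes "r \<ge> 2"
  shows "wf_multigraph (expanded_petersen r)"
proof -
  have ends: "e \<subseteq> {..<10} \<times> {..<r} \<and> card e = 2" if "e \<in> medges (expanded_petersen r)" for e
  proof -
    from that consider (clique) "e \<in> clique_edges r" | (mate) "e \<in> mate_edges r"
      by (auto simp: medges_expanded)
    then show ?thesis
    proof cases
      case clique
      then show ?thesis by (auto simp: clique_edges_def block_def)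
    next
      case mate
      then obtain x where x: "e = {x, mate x}" "x \<in> {..<10} \<times> {..<r}"
        by (auto simp: mate_edges_def)
      moreover have "x \<noteq> mate x"
        using fst_mate_neq[of x] x by force
      ultimately show ?thesis
        using mate_in_mverts[OF assms, of x] by (auto simp: mverts_expanded)
    qed
  qed
  then have "medges (expanded_petersen r) \<subseteq> Pow ({..<10} \<times> {..<r})"
    by blast
  then have "finite (medges (expanded_petersen r))"
    by (rule finite_subset) simp
  with ends show ?thesis
    unfolding wf_multigraph_def mverts_expanded ends_expanded by simp
qed

text \<open>A vertex has \<open>r - 1\<close> neighbours in its own block and its mate in another
  block.\<close>

lemma mregular_expanded:
  assumes "r \<ge> 2"
  shows "mregular r (expanded_petersen r)"
  unfolding mregular_def
proof
  fix x assume x: "x \<in> mverts (expanded_petersen r)"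
  define p where "p = fst x"
  have p: "p < 10" "x \<in> block r p"
    using x by (auto simp: p_def mverts_expanded block_def)
  have "{e \<in> clique_edges r. x \<in> e} = (\<lambda>y. {x, y}) ` (block r p - {x})"
    using p by (auto simp: clique_edges_def block_def)
  then have "{e \<in> medges (expanded_petersen r). x \<in> e}
      = (\<lambda>y. {x, y}) ` insert (mate x) (block r p - {x})"
    using incident_mate_edges[OF x] by (auto simp: medges_expanded)
  moreover have "inj (\<lambda>y. {x, y})"
    by (auto simp: inj_def doubleton_eq_iff)
  moreover have "card (insert (mate x) (block r p - {x})) = r"
    using p mate_not_in_block[OF p] assms by simp
  ultimately show "mdegree (expanded_petersen r) x = r"
    unfolding mdegree_def by (metis (no_types, lifting) Collect_cong card_image ends_expanded inj_on_subset subset_UNIV)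
qed

lemma connected_expanded:
  assumes "r \<ge> 3"
  shows "connected_multigraph (expanded_petersen r)"
proof -
  define R where "R = (adj_rel (expanded_petersen r))\<^sup>*"
  have "sym R"
    unfolding R_def by (intro sym_rtrancl) (auto simp: sym_def adj_rel_def insert_commute)
  have "trans R"
    unfolding R_def by (rule trans_rtrancl)
  have clique: "((p, i), (p, j)) \<in> R" if "p < 10" "i < r" "j < r" for p i j
  proof (cases "i = j")
    case False
    then have "((p, i), (p, j)) \<in> adj_rel (expanded_petersen r)"
      using that by (auto simp: adj_rel_def medges_expanded clique_edges_def block_def)
    then show ?thesis unfolding R_def by blast
  qed (simp add: R_def)
  have mate: "(x, mate x) \<in> R" if "x \<in> mverts (expanded_petersen r)" for x
    using that unfolding R_def
    by (intro r_into_rtrancl) (auto simp: adj_rel_def medges_expanded mverts_expanded mate_edges_def)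
  \<comment> \<open>Index 0 represents its block: a mate edge between two blocks extends to a walk
    between their representatives through clique edges.\<close>
  have hop: "((p, 0), (q, 0)) \<in> R" if "mate (p, i) = (q, j)" "p < 10" "i < r" for p q i j
  proof -
    have "q < 10" "j < r"
      using mate_in_mverts[of r "(p, i)"] that assms by (auto simp: mverts_expanded)
    moreover have "((p, i), (q, j)) \<in> R"
      using mate[of "(p, i)"] that by (auto simp: mverts_expanded)
    ultimately show ?thesis
      using clique[of p 0 i] clique[of q j 0] that assms transD[OF \<open>trans R\<close>]
      by (metis gr_implies_not0 neq0_conv)
  qed
  have outer: "((p, 0), (0, 0)) \<in> R" if "p < 5" for p
  proof -
    have "((4, 0), (0, 0)) \<in> R" "((3, 0), (4, 0)) \<in> R" "((2, 0), (3, 0)) \<in> R" "((1, 0), (2, 0)) \<in> R"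
      using assms by (auto intro!: hop[where i = 0 and j = 1] simp: mate.simps)
    moreover have "((0, 0), (0, 0)) \<in> R"
      unfolding R_def by simp
    ultimately show ?thesis
      using less_5_cases[OF that] transD[OF \<open>trans R\<close>] by metis
  qed
  have base: "((p, i), (0, 0)) \<in> R" if x: "p < 10" "i < r" for p i
  proof -
    have "((p, 0), (0, 0)) \<in> R"
    proof (cases "p < 5")
      case False
      \<comment> \<open>An inner vertex reaches the outer cycle by the spoke with the smallest
        index, 2, which exists because \<open>r \<ge> 3\<close>.\<close>
      then have "mate (p, 2) = (p - 5, 2)"
        using x less_10_cases[of p] by (auto simp: mate.simps)
      then have "((p, 0), (p - 5, 0)) \<in> R"
        using hop x assms by force
      then show ?thesis
        using outer[of "p - 5"] x transD[OF \<open>trans R\<close>] by force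
    qed (use outer in simp)
    then show ?thesis
      using clique[of p i 0] x transD[OF \<open>trans R\<close>] by (metis gr_implies_not0 neq0_conv)
  qed
  have "(x, y) \<in> R"
    if "x \<in> mverts (expanded_petersen r)" "y \<in> mverts (expanded_petersen r)" for x y
  proof -
    have "(x, (0, 0)) \<in> R" "(y, (0, 0)) \<in> R"
      using base that by (auto simp: mverts_expanded)
    then show ?thesis
      using symD[OF \<open>sym R\<close>] transD[OF \<open>trans R\<close>] by blast
  qed
  moreover have "(0, 0) \<in> mverts (expanded_petersen r)"
    using assms by (simp add: mverts_expanded)
  ultimately show ?thesis
    unfolding connected_multigraph_def R_def by blast
qed

lemma perfect_matching_mate_edges: "perfect_matching (expanded_petersen r) (mate_edges r)"
  by (auto simp: perfect_matching_iff_card medges_expanded incident_mate_edges)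

lemma doubleton_in_boundary_iff:
  assumes "x \<noteq> y"
  shows "{x, y} \<in> edge_boundary (expanded_petersen r) X \<longleftrightarrow>
    {x, y} \<in> medges (expanded_petersen r) \<and> (x \<in> X \<longleftrightarrow> y \<notin> X)"
  using assms by (cases "x \<in> X"; cases "y \<in> X") (auto simp: edge_boundary_def Int_insert_left)

section \<open>Odd cuts of the expanded Petersen graph\<close>

text \<open>If a block is split into parts of sizes \<open>b + 1\<close> and \<open>c + 1\<close>,
  the cut contains all (b + 1)(c + 1) clique edges between them, and this is at least b + c + 1 = r
  - 1.\<close>

lemma card_boundary_partial_block:
  assumes "r \<ge> 2" and "p < 10" and "X \<inter> block r p \<noteq> {}" and "\<not> block r p \<subseteq> X"
  shows "r - 1 \<le> card (edge_boundary (expanded_petersen r) X)"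
proof -
  define B where "B = X \<inter> block r p"
  define C where "C = block r p - X"
  have fin: "finite B" "finite C"
    by (simp_all add: B_def C_def)
  have "card B + card C = card (block r p)"
    unfolding B_def C_def by (metis Diff_Int Diff_cancel Un_empty_right card_Int_Diff finite_block Int_commute)
  then have r: "card B + card C = r"
    by simp
  have "card B \<ge> 1" "card C \<ge> 1"
    using assms fin by (auto simp: B_def C_def Suc_le_eq card_gt_0_iff)
  then obtain b c where "card B = Suc b" "card C = Suc c"
    by (metis Suc_le_D One_nat_def)
  then have "r - 1 \<le> card (B \<times> C)"
    using r by (auto simp: card_cartesian_product)
  also have "\<dots> = card ((\<lambda>(x, y). {x, y}) ` (B \<times> C))"
    by (intro card_image[symmetric]) (auto simp: inj_on_def doubleton_eq_iff B_def C_def)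
  also have "\<dots> \<le> card (edge_boundary (expanded_petersen r) X)"
  proof (rule card_mono)
    show "finite (edge_boundary (expanded_petersen r) X)"
      using wf_expanded[OF assms(1)] by (simp add: edge_boundary_def wf_multigraph_def)
    have "{x, y} \<in> edge_boundary (expanded_petersen r) X" if "x \<in> B" "y \<in> C" for x y
    proof -
      have "x \<in> block r p" "y \<in> block r p" "x \<noteq> y"
        using that by (auto simp: B_def C_def)
      then have "{x, y} \<in> medges (expanded_petersen r)" "x \<noteq> y"
        using assms(2) unfolding medges_expanded clique_edges_def by blast+
      then show ?thesis
        using that by (simp add: doubleton_in_boundary_iff B_def C_def)
    qed
    then show "(\<lambda>(x, y). {x, y}) ` (B \<times> C) \<subseteq> edge_boundary (expanded_petersen r) X"
      by auto
  qed
  finally show ?thesis .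
qed

text \<open>Besides the parallel spokes at one place, the cut contains at least one more edge of the Petersen graph.\<close>

lemma card_boundary_blocks:
  assumes "r \<ge> 3" and Y: "Y \<subseteq> {..<10}" and "odd (card Y)"
  shows "r - 1 \<le> card (edge_boundary (expanded_petersen r) (Y \<times> {..<r}))"
proof -
  let ?X = "Y \<times> {..<r}"
  \<comment> \<open>Were no spoke cut, \<open>Y\<close> would consist of pairs \<open>j\<close>,
    \<open>j + 5\<close> and have even size.\<close>
  have "\<exists>j<5. (j \<in> Y) \<noteq> (j + 5 \<in> Y)"
  proof (rule ccontr)
    assume "\<not> ?thesis"
    then have *: "j \<in> Y \<longleftrightarrow> j + 5 \<in> Y" if "j < 5" for j
      using that by blast
    have "p \<in> (Y \<inter> {..<5}) \<union> (\<lambda>j. j + 5) ` (Y \<inter> {..<5})" if "p \<in> Y" for p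
    proof (cases "p < 5")
      case False
      then have "p = (p - 5) + 5" "p - 5 < 5"
        using that Y by auto
      then show ?thesis
        using *[of "p - 5"] that by (metis IntI UnI2 image_eqI lessThan_iff)
    qed (use that in simp)
    moreover have "(\<lambda>j. j + 5) ` (Y \<inter> {..<5}) \<subseteq> Y"
      using * by blast
    ultimately have "Y = (Y \<inter> {..<5}) \<union> (\<lambda>j. j + 5) ` (Y \<inter> {..<5})"
      by blast
    moreover have "card ((Y \<inter> {..<5}) \<union> (\<lambda>j. j + 5) ` (Y \<inter> {..<5})) = 2 * card (Y \<inter> {..<5})"
      by (subst card_Un_disjoint) (auto simp: card_image)
    ultimately show False
      using \<open>odd (card Y)\<close> by (metis dvd_triv_left)
  qed
  then obtain j where j: "j < 5" "(j \<in> Y) \<noteq> (j + 5 \<in> Y)"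
    by blast
  \<comment> \<open>Otherwise no cycle edge is cut, so \<open>Y\<close> contains all or none of each
    5-cycle. At least one of the spokes at 0 and 1 is not at \<open>j\<close>; being uncut, it makes
    both cycles agree, contrary to the choice of \<open>j\<close>.\<close>
  have "\<exists>x. x \<in> mverts (expanded_petersen r) \<and> (x \<in> ?X) \<noteq> (mate x \<in> ?X) \<and>
      \<not> (snd x \<ge> 2 \<and> (fst x = j \<or> fst x = j + 5))"
  proof (rule ccontr)
    assume "\<not> ?thesis"
    then have *: "((p, i) \<in> ?X) = (mate (p, i) \<in> ?X)"
      if "p < 10" "i < r" "i < 2 \<or> p \<noteq> j \<and> p \<noteq> j + 5" for p i
      using that by (force simp: mverts_expanded)
    have spokes: "q \<in> Y \<longleftrightarrow> q + 5 \<in> Y" if "q < 5" "q \<noteq> j" for q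
      using *[of q 2] that j assms by (auto simp: mate.simps)
    have "0 \<in> Y \<longleftrightarrow> 1 \<in> Y" "1 \<in> Y \<longleftrightarrow> 2 \<in> Y" "2 \<in> Y \<longleftrightarrow> 3 \<in> Y" "3 \<in> Y \<longleftrightarrow> 4 \<in> Y"
      "5 \<in> Y \<longleftrightarrow> 7 \<in> Y" "6 \<in> Y \<longleftrightarrow> 8 \<in> Y" "7 \<in> Y \<longleftrightarrow> 9 \<in> Y" "8 \<in> Y \<longleftrightarrow> 5 \<in> Y"
      using *[of 0 0] *[of 1 0] *[of 2 0] *[of 3 0] *[of 5 0] *[of 6 0] *[of 7 0] *[of 8 0] assms
      by (simp_all add: mate.simps flip: numeral_2_eq_2)
    then show False
      using j less_5_cases[OF j(1)] spokes[of 0] spokes[of 1] by auto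
  qed
  then obtain x where x: "x \<in> mverts (expanded_petersen r)" "(x \<in> ?X) \<noteq> (mate x \<in> ?X)"
    and far: "\<not> (snd x \<ge> 2 \<and> (fst x = j \<or> fst x = j + 5))"
    by (elim exE conjE) (rule that)
  \<comment> \<open>The \<open>r - 2\<close> parallel spokes at \<open>j\<close> are all cut; the
    edge at \<open>x\<close> is one more.\<close>
  let ?S = "(\<lambda>i. {(j, i), (j + 5, i)}) ` {2..<r}"
  have "inj_on (\<lambda>i. {(j, i), (j + 5, i)}) {2..<r}"
    by (auto simp: inj_on_def doubleton_eq_iff)
  then have "card ?S = r - 2"
    by (simp add: card_image)
  moreover have "{x, mate x} \<notin> ?S"
  proof
    assume "{x, mate x} \<in> ?S"
    then obtain i where "i \<ge> 2" "x \<in> {(j, i), (j + 5, i)}"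
      by (metis (no_types, lifting) atLeastLessThan_iff imageE insertI1)
    then show False
      using far by auto
  qed
  ultimately have card: "card (insert {x, mate x} ?S) = r - 1"
    using assms by simp
  have sub: "insert {x, mate x} ?S \<subseteq> edge_boundary (expanded_petersen r) ?X"
  proof -
    have "{x, mate x} \<in> medges (expanded_petersen r)" "x \<noteq> mate x"
      using x by (auto simp: medges_expanded mate_edges_def mverts_expanded)
    then have "{x, mate x} \<in> edge_boundary (expanded_petersen r) ?X"
      using x by (simp add: doubleton_in_boundary_iff)
    moreover have "{(j, i), (j + 5, i)} \<in> edge_boundary (expanded_petersen r) ?X"
      if "2 \<le> i" "i < r" for i
    proof -
      have "mate (j, i) = (j + 5, i)" "(j, i) \<in> {..<10} \<times> {..<r}"
        using that j by (auto simp: mate.simps)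
      then have "{(j, i), (j + 5, i)} \<in> mate_edges r"
        unfolding mate_edges_def by (metis (mono_tags, lifting) image_eqI)
      then show ?thesis
        using that j by (auto simp: doubleton_in_boundary_iff medges_expanded)
    qed
    ultimately show ?thesis
      by auto
  qed
  have "finite (edge_boundary (expanded_petersen r) ?X)"
    using wf_expanded[of r] assms by (simp add: edge_boundary_def wf_multigraph_def)
  then show ?thesis
    using card_mono[OF _ sub] card by simp
qed

text \<open>A bound of \<open>r - 1\<close> suffices: \<open>r\<close> and the size of
  \<open>X\<close> are odd, so the cut is odd, whereas \<open>r - 1\<close> is even. The bound comes
  from a block that \<open>X\<close> splits or, if there is none, from \<open>X\<close> being a
  union of blocks.\<close>

lemma r_graph_expanded:
  assumes "r \<ge> 3" and "odd r"
  shows "r_graph r (expanded_petersen r)"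
proof -
  have wf: "wf_multigraph (expanded_petersen r)" and reg: "mregular r (expanded_petersen r)"
    using assms wf_expanded mregular_expanded by auto
  have "r \<le> card (edge_boundary (expanded_petersen r) X)"
    if X: "X \<subseteq> mverts (expanded_petersen r)" and odd: "odd (card X)" for X
  proof -
    have "r - 1 \<le> card (edge_boundary (expanded_petersen r) X)"
    proof (cases "\<exists>p<10. X \<inter> block r p \<noteq> {} \<and> \<not> block r p \<subseteq> X")
      case True
      then obtain p where "p < 10" "X \<inter> block r p \<noteq> {}" "\<not> block r p \<subseteq> X"
        by blast
      then show ?thesis
        using card_boundary_partial_block[of r p X] assms by simp
    next
      case False
      define Y where "Y = fst ` X"
      have "X = Y \<times> {..<r}"
      proof
        show "X \<subseteq> Y \<times> {..<r}"
          using X by (force simp: Y_def mverts_expanded)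
        show "Y \<times> {..<r} \<subseteq> X"
        proof clarify
          fix p i assume "p \<in> Y" "i < r"
          then obtain l where l: "(p, l) \<in> X"
            by (auto simp: Y_def)
          then have p: "p < 10" and "l < r"
            using X by (auto simp: mverts_expanded)
          then have "(p, l) \<in> X \<inter> block r p"
            using l by (simp add: block_def)
          then have "block r p \<subseteq> X"
            using False p by blast
          then show "(p, i) \<in> X"
            using \<open>i < r\<close> by (auto simp: block_def)
        qed
      qed
      moreover have "Y \<subseteq> {..<10}"
        using X by (auto simp: Y_def mverts_expanded)
      moreover from calculation have "odd (card Y)"
        using odd by (simp add: card_cartesian_product)
      ultimately show ?thesis
        using card_boundary_blocks assms by metis
    qed
    moreover have "odd (card (edge_boundary (expanded_petersen r) X))"
    proof -
      have "odd (card {e \<in> medges (expanded_petersen r). v \<in> ends (expanded_petersen r) e})"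
        if "v \<in> X" for v
        using reg X that assms unfolding mregular_def mdegree_def by auto
      then have "odd (card (medges (expanded_petersen r) \<inter> edge_boundary (expanded_petersen r) X))"
        using odd_card_boundary_iff[OF wf subset_refl X] odd by blast
      moreover have "medges (expanded_petersen r) \<inter> edge_boundary (expanded_petersen r) X =
          edge_boundary (expanded_petersen r) X"
        by (auto simp: edge_boundary_def)
      ultimately show ?thesis
        by simp
    qed
    ultimately show ?thesis
      using assms by presburger
  qed
  then show ?thesis
    using wf reg connected_expanded assms unfolding r_graph_def by blast
qed

section \<open>Perfect matchings of the expanded Petersen graph\<close>

text \<open>This encodes the trace of \<open>M\<close> on \<open>F\<close> by the ends of its edges,
  so that boundary edges of a block can be counted as vertices of the block.\<close>

definition matched_verts :: "nat \<Rightarrow> (nat \<times> nat) set set \<Rightarrow> (nat \<times> nat) set" where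
  "matched_verts r M = {x \<in> mverts (expanded_petersen r). {x, mate x} \<in> M}"

lemma mate_in_matched_verts:
  assumes "r \<ge> 2" and x: "x \<in> matched_verts r M"
  shows "mate x \<in> matched_verts r M"
proof -
  have "mate (mate x) = x"
    using x by (intro mate_mate) (auto simp: matched_verts_def mverts_expanded)
  then show ?thesis
    using x mate_in_mverts[OF assms(1), of x] unfolding matched_verts_def
    by (simp add: insert_commute)
qed

text \<open>Edges leaving a block are mate edges, each with exactly one end in the block. Hence the
  vertices counted here correspond to the edges of \<open>M\<close> in the boundary of a set of odd
  size \<open>r\<close>.\<close>

lemma odd_card_matched_verts_block:
  assumes r: "r \<ge> 2" "odd r" and M: "perfect_matching (expanded_petersen r) M" and p: "p < 10"
  shows "odd (card (matched_verts r M \<inter> block r p))"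
proof -
  let ?f = "\<lambda>x. {x, mate x}"
  have M_sub: "M \<subseteq> clique_edges r \<union> mate_edges r"
    using M by (simp add: perfect_matching_def medges_expanded)
  have "M \<inter> edge_boundary (expanded_petersen r) (block r p) = ?f ` (matched_verts r M \<inter> block r p)"
    (is "?L = ?R")
  proof
    show "?R \<subseteq> ?L"
    proof clarify
      fix q i assume x: "(q, i) \<in> matched_verts r M" "(q, i) \<in> block r p"
      have "mate (q, i) \<notin> block r p"
        using mate_not_in_block[OF p x(2)] .
      moreover from this x have "(q, i) \<noteq> mate (q, i)"
        by metis
      ultimately show "?f (q, i) \<in> ?L"
        using x M_sub doubleton_in_boundary_iff[of "(q, i)" "mate (q, i)" r "block r p"]
        by (auto simp: matched_verts_def medges_expanded)
    qed
  next
    show "?L \<subseteq> ?R"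
    proof
      fix e assume e: "e \<in> ?L"
      have "e \<notin> clique_edges r"
      proof
        assume "e \<in> clique_edges r"
        then obtain x y q where xy: "e = {x, y}" "x \<in> block r q" "y \<in> block r q" "x \<noteq> y"
          unfolding clique_edges_def by blast
        then have "x \<in> block r p \<longleftrightarrow> y \<in> block r p"
          by (auto simp: block_def)
        then show False
          using e xy doubleton_in_boundary_iff[OF xy(4), of r "block r p"] by blast
      qed
      then have "e \<in> mate_edges r"
        using e M_sub by blast
      then obtain x where x: "e = ?f x" "x \<in> mverts (expanded_petersen r)"
        by (auto simp: mate_edges_def mverts_expanded)
      then have mm: "mate (mate x) = x"
        by (intro mate_mate) (auto simp: mverts_expanded)
      have "x \<in> matched_verts r M"
        using e x by (simp add: matched_verts_def)
      moreover from this have "mate x \<in> matched_verts r M"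
        by (rule mate_in_matched_verts[OF r(1)])
      moreover have "x \<noteq> mate x"
        using x fst_mate_neq[of x] by (auto simp: mverts_expanded)
      then have "x \<in> block r p \<or> mate x \<in> block r p"
        using e x doubleton_in_boundary_iff[of x "mate x" r "block r p"] by blast
      moreover have "e = ?f (mate x)"
        using x mm by (simp add: insert_commute)
      ultimately show "e \<in> ?R"
        using x(1) by blast
    qed
  qed
  moreover have "inj_on ?f (matched_verts r M \<inter> block r p)"
    unfolding inj_on_def using mate_not_in_block[OF p] by (metis IntD2 doubleton_eq_iff)
  ultimately have "card (matched_verts r M \<inter> block r p) =
      card (M \<inter> edge_boundary (expanded_petersen r) (block r p))"
    by (simp add: card_image)
  then show ?thesis
    using perfect_matching_odd_boundary[OF wf_expanded[OF r(1)] M block_subset[OF p]] r(2) by simp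
qed

text \<open>
  Here \<open>a\<^sub>j\<close> and \<open>b\<^sub>j\<close> tell whether a perfect matching of the Petersen graph contains the edge leaving
  the \<open>j\<close>-th outer and inner vertex; both ends of a spoke are covered by
  cycle edges, or neither is.
\<close>

lemma petersen_parity:
  assumes "\<not> (a0 \<and> a1)" "\<not> (a1 \<and> a2)" "\<not> (a2 \<and> a3)" "\<not> (a3 \<and> a4)" "\<not> (a4 \<and> a0)"
    and "a0 \<or> a4 \<longleftrightarrow> b0 \<or> b3" "a1 \<or> a0 \<longleftrightarrow> b1 \<or> b4" "a2 \<or> a1 \<longleftrightarrow> b2 \<or> b0"
      "a3 \<or> a2 \<longleftrightarrow> b3 \<or> b1" "a4 \<or> a3 \<longleftrightarrow> b4 \<or> b2"
  shows "even (of_bool a0 + of_bool a1 + of_bool a2 + of_bool a3 + of_bool a4 :: nat)"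
  \<comment> \<open>At most two edges of a 5-cycle are disjoint, so an odd count means one outer
    edge. Then just two inner vertices, with consecutive indices, would be covered by inner edges,
    which join indices at distance 2.\<close>
  using assms by (cases a0; cases a1; cases a2; cases a3; cases a4) simp_all

text \<open>Contracting the blocks turns \<open>T\<close> into a perfect matching of the Petersen
  graph with multiplied spokes. \<open>T\<close> is kept abstract because the vertices left over by
  all the matchings are treated in the same way.\<close>

lemma even_outer_edges:
  assumes T: "\<And>x. x \<in> T \<Longrightarrow> mate x \<in> T"
    and one: "\<And>p. p < 10 \<Longrightarrow> card (T \<inter> block r p) = 1" and "r \<ge> 3"
  shows "even (card {j \<in> {..<5}. (j, 0) \<in> T})"
proof -
  have "\<exists>i<r. T \<inter> block r p = {(p, i)}" if p: "p < 10" for p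
  proof -
    obtain x where x: "T \<inter> block r p = {x}"
      using one[OF p] by (auto simp: card_1_singleton_iff)
    then have "x \<in> block r p"
      by blast
    then show ?thesis
      using x by (auto simp: block_def)
  qed
  \<comment> \<open>The index \<open>c p\<close> tells how \<open>p\<close> is covered: 0 by the
    leaving cycle edge, 1 by the entering one, at least 2 by a spoke.\<close>
  then obtain c where c: "\<And>p. p < 10 \<Longrightarrow> c p < r \<and> T \<inter> block r p = {(p, c p)}"
    by metis
  have T_iff: "(p, i) \<in> T \<longleftrightarrow> i = c p" if "p < 10" "i < r" for p i
    using c[OF that(1)] that(2) by (auto simp: block_def set_eq_iff)
  have T_mate: "(p, i) \<in> T \<longleftrightarrow> mate (p, i) \<in> T" if "p < 10" for p i
    using T mate_mate[of "(p, i)"] that by (metis fst_conv)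
  have cyc: "c p = 0 \<longleftrightarrow> c q = 1" if "mate (p, 0) = (q, 1)" "p < 10" "q < 10" for p q
    using T_mate[of p 0] T_iff[of p 0] T_iff[of q 1] that assms by auto
  have spoke: "c p \<ge> 2 \<longleftrightarrow> c (p + 5) \<ge> 2" if "p < 5" for p
  proof -
    have *: "c (p + 5) = i \<longleftrightarrow> c p = i" if "i \<ge> 2" "i < r" for i
    proof -
      have "mate (p, i) = (p + 5, i)"
        using \<open>p < 5\<close> that by (simp add: mate.simps)
      then show ?thesis
        using T_mate[of p i] T_iff[of p i] T_iff[of "p + 5" i] \<open>p < 5\<close> that by auto
    qed
    have "c p < r" "c (p + 5) < r"
      using c that by simp_all
    then show ?thesis
      using * by metis
  qed
  have outer: "c 0 = 0 \<longleftrightarrow> c 1 = 1" "c 1 = 0 \<longleftrightarrow> c 2 = 1" "c 2 = 0 \<longleftrightarrow> c 3 = 1"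
      "c 3 = 0 \<longleftrightarrow> c 4 = 1" "c 4 = 0 \<longleftrightarrow> c 0 = 1"
    and inner: "c 5 = 0 \<longleftrightarrow> c 7 = 1" "c 6 = 0 \<longleftrightarrow> c 8 = 1" "c 7 = 0 \<longleftrightarrow> c 9 = 1"
      "c 8 = 0 \<longleftrightarrow> c 5 = 1" "c 9 = 0 \<longleftrightarrow> c 6 = 1"
    by (rule cyc; simp add: mate.simps)+
  have spoke': "c p = 0 \<or> c p = 1 \<longleftrightarrow> c q = 0 \<or> c q = 1" if "p < 5" "q = p + 5" for p q
  proof -
    have "n \<ge> 2 \<longleftrightarrow> \<not> (n = 0 \<or> n = 1)" for n :: nat
      by auto
    then show ?thesis
      using spoke[OF that(1)] that(2) by metis
  qed
  have spokes: "c 0 = 0 \<or> c 0 = 1 \<longleftrightarrow> c 5 = 0 \<or> c 5 = 1" "c 1 = 0 \<or> c 1 = 1 \<longleftrightarrow> c 6 = 0 \<or> c 6 = 1"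
    "c 2 = 0 \<or> c 2 = 1 \<longleftrightarrow> c 7 = 0 \<or> c 7 = 1" "c 3 = 0 \<or> c 3 = 1 \<longleftrightarrow> c 8 = 0 \<or> c 8 = 1"
    "c 4 = 0 \<or> c 4 = 1 \<longleftrightarrow> c 9 = 0 \<or> c 9 = 1"
    by (rule spoke'; simp)+
  have "even (of_bool (c 0 = 0) + of_bool (c 1 = 0) + of_bool (c 2 = 0) + of_bool (c 3 = 0) +
      of_bool (c 4 = 0) :: nat)"
  proof (rule petersen_parity)
    show "\<not> (c 0 = 0 \<and> c 1 = 0)" "\<not> (c 1 = 0 \<and> c 2 = 0)" "\<not> (c 2 = 0 \<and> c 3 = 0)"
      "\<not> (c 3 = 0 \<and> c 4 = 0)" "\<not> (c 4 = 0 \<and> c 0 = 0)"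
      using outer by (metis zero_neq_one)+
    show "c 0 = 0 \<or> c 4 = 0 \<longleftrightarrow> c 5 = 0 \<or> c 8 = 0" "c 1 = 0 \<or> c 0 = 0 \<longleftrightarrow> c 6 = 0 \<or> c 9 = 0"
      "c 2 = 0 \<or> c 1 = 0 \<longleftrightarrow> c 7 = 0 \<or> c 5 = 0" "c 3 = 0 \<or> c 2 = 0 \<longleftrightarrow> c 8 = 0 \<or> c 6 = 0"
      "c 4 = 0 \<or> c 3 = 0 \<longleftrightarrow> c 9 = 0 \<or> c 7 = 0"
      \<comment> \<open>The rewriting replaces each entering edge by the leaving edge of the
        preceding vertex.\<close>
      using spokes unfolding outer[symmetric] inner[symmetric] .
  qed
  moreover have "{j \<in> {..<5}. (j, 0) \<in> T} = {j \<in> {..<5}. c j = 0}"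
    using T_iff assms by auto
  moreover have "card {j \<in> {..<5}. c j = 0} = (\<Sum>j<5. of_bool (c j = 0))"
    by (simp add: of_bool_def sum.If_cases Int_def)
  moreover have "(\<Sum>j<5. of_bool (c j = 0) :: nat) = of_bool (c 0 = 0) + of_bool (c 1 = 0) +
      of_bool (c 2 = 0) + of_bool (c 3 = 0) + of_bool (c 4 = 0)"
    by (simp add: eval_nat_numeral)
  ultimately show ?thesis
    by simp
qed

section \<open>Counting disjoint traces\<close>

text \<open>The five outer vertices with index 0 stand for the five outer edges. They are
  partitioned by the sets \<open>T i\<close> and the remainder \<open>U\<close>, each of which
  contains an even number of them.\<close>

lemma no_disjoint_traces:
  assumes k: "k \<ge> 1" and r: "r = 2 * k + 1"
    and V: "\<And>i. i \<in> {1..2 * k} \<Longrightarrow> T i \<subseteq> mverts (expanded_petersen r)"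
    and mate: "\<And>i x. i \<in> {1..2 * k} \<Longrightarrow> x \<in> T i \<Longrightarrow> mate x \<in> T i"
    and odd: "\<And>i p. i \<in> {1..2 * k} \<Longrightarrow> p < 10 \<Longrightarrow> odd (card (T i \<inter> block r p))"
    and disj: "\<And>i j. i \<in> {1..2 * k} \<Longrightarrow> j \<in> {1..2 * k} \<Longrightarrow> i \<noteq> j \<Longrightarrow> T i \<inter> T j = {}"
  shows False
proof -
  let ?I = "{1..2 * k}"
  define U where "U = mverts (expanded_petersen r) - (\<Union>i\<in>?I. T i)"
  have fin: "finite (T i)" if "i \<in> ?I" for i
    using V[OF that] by (rule finite_subset) simp
  have total: "card (U \<inter> A) + (\<Sum>i\<in>?I. card (T i \<inter> A)) = card A"
    if A: "A \<subseteq> mverts (expanded_petersen r)" for A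
  proof -
    have "(\<Sum>i\<in>?I. card (T i \<inter> A)) = card (\<Union>i\<in>?I. T i \<inter> A)"
    proof (intro card_UN_disjoint[symmetric] ballI impI)
      show "(T i \<inter> A) \<inter> (T j \<inter> A) = {}" if "i \<in> ?I" "j \<in> ?I" "i \<noteq> j" for i j
        using disj[OF that] by blast
    qed (use fin in simp_all)
    moreover have "card A = card (U \<inter> A \<union> (\<Union>i\<in>?I. T i \<inter> A))"
      using A by (intro arg_cong[of _ _ card]) (auto simp: U_def)
    moreover have "\<dots> = card (U \<inter> A) + card (\<Union>i\<in>?I. T i \<inter> A)"
      using fin by (intro card_Un_disjoint) (auto simp: U_def)
    ultimately show ?thesis
      by simp
  qed
  have one: "card (T i \<inter> block r p) = 1" if i: "i \<in> ?I" and p: "p < 10" for i p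
  proof -
    have pos: "1 \<le> card (T j \<inter> block r p)" if "j \<in> ?I" for j
      using odd[OF that p] by (cases "card (T j \<inter> block r p)") auto
    \<comment> \<open>The other \<open>2 * k - 1\<close> sets take at least one vertex each from a
      block of \<open>2 * k + 1\<close>, leaving at most two for \<open>T i\<close>; oddness then
      gives one.\<close>
    have "2 * k - 1 = (\<Sum>j\<in>?I - {i}. 1)"
      using i by simp
    also have "\<dots> \<le> (\<Sum>j\<in>?I - {i}. card (T j \<inter> block r p))"
      by (rule sum_mono) (use pos in auto)
    finally have "2 * k - 1 + card (T i \<inter> block r p) \<le> (\<Sum>j\<in>?I. card (T j \<inter> block r p))"
      using i by (subst sum.remove[OF _ i]) auto
    then have "card (T i \<inter> block r p) \<le> 2"
      using total[OF block_subset[OF p]] r k by simp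
    moreover have "card (T i \<inter> block r p) \<noteq> 2"
      using odd[OF i p] by auto
    ultimately show ?thesis
      using pos[OF i] by simp
  qed
  have even_T: "even (card (T i \<inter> (\<lambda>j. (j, 0)) ` {..<5}))" if "i \<in> ?I" for i
  proof -
    have "even (card {j \<in> {..<5}. (j, 0) \<in> T i})"
      using even_outer_edges[of "T i" r] mate one that k r by simp
    moreover have "T i \<inter> (\<lambda>j. (j, 0)) ` {..<5} = (\<lambda>j. (j, 0)) ` {j \<in> {..<5}. (j, 0) \<in> T i}"
      by auto
    ultimately show ?thesis
      by (simp add: card_image inj_on_def)
  qed
  have "even (card (U \<inter> (\<lambda>j. (j, 0)) ` {..<5}))"
  proof -
    have "mate x \<in> U" if "x \<in> U" for x
    proof -
      have "mate (mate x) = x"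
        using that by (intro mate_mate) (auto simp: U_def mverts_expanded)
      then show ?thesis
        using that mate mate_in_mverts[of r x] k r unfolding U_def by fastforce
    qed
    moreover have "card (U \<inter> block r p) = 1" if "p < 10" for p
      using total[OF block_subset[OF that]] one[OF _ that] r by simp
    ultimately have "even (card {j \<in> {..<5}. (j, 0) \<in> U})"
      using even_outer_edges[of U r] k r by simp
    moreover have "U \<inter> (\<lambda>j. (j, 0)) ` {..<5} = (\<lambda>j. (j, 0)) ` {j \<in> {..<5}. (j, 0) \<in> U}"
      by auto
    ultimately show ?thesis
      by (simp add: card_image inj_on_def)
  qed
  moreover have "even (\<Sum>i\<in>?I. card (T i \<inter> (\<lambda>j. (j, 0)) ` {..<5}))"
    using even_T by (rule dvd_sum)
  moreover have "card ((\<lambda>j::nat. (j, 0::nat)) ` {..<5}) = 5"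
    by (subst card_image) (auto simp: inj_on_def)
  moreover have "(\<lambda>j::nat. (j, 0::nat)) ` {..<5} \<subseteq> mverts (expanded_petersen r)"
    using r by (auto simp: mverts_expanded)
  ultimately have "even (5::nat)"
    using total by (metis even_add)
  then show False
    by simp
qed

lemma mate_edges_meet:
  assumes k: "k \<ge> 1"
    and Ms: "\<And>i. i \<in> {1..2 * k} \<Longrightarrow> perfect_matching (expanded_petersen (2 * k + 1)) (Ms i)"
  shows "\<exists>i j. 1 \<le> i \<and> i < j \<and> j \<le> 2 * k \<and> mate_edges (2 * k + 1) \<inter> Ms i \<inter> Ms j \<noteq> {}"
proof (rule ccontr)
  let ?T = "\<lambda>i. matched_verts (2 * k + 1) (Ms i)"
  assume "\<not> ?thesis"
  then have *: "mate_edges (2 * k + 1) \<inter> Ms i \<inter> Ms j = {}" if "1 \<le> i" "i < j" "j \<le> 2 * k" for i j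
    using that by blast
  \<comment> \<open>A common vertex \<open>x\<close> would give the common edge
    \<open>{x, mate x}\<close> of \<open>F\<close>.\<close>
  have "?T i \<inter> ?T j = {}" if "1 \<le> i" "i < j" "j \<le> 2 * k" for i j
    using *[OF that] by (auto simp: matched_verts_def mate_edges_def mverts_expanded)
  then have disj: "?T i \<inter> ?T j = {}" if "i \<in> {1..2 * k}" "j \<in> {1..2 * k}" "i \<noteq> j" for i j
    using that by (metis Int_commute atLeastAtMost_iff nat_neq_iff)
  show False
  proof (rule no_disjoint_traces[OF k refl, of ?T])
    show "?T i \<subseteq> mverts (expanded_petersen (2 * k + 1))" for i
      by (auto simp: matched_verts_def)
    show "mate x \<in> ?T i" if "x \<in> ?T i" for i x
      using mate_in_matched_verts that k by simp
    show "odd (card (?T i \<inter> block (2 * k + 1) p))" if "i \<in> {1..2 * k}" "p < 10" for i p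
      using odd_card_matched_verts_block Ms that k by simp
  qed (use disj in auto)
qed

section \<open>Transfer to natural number labels\<close>

theorem theorem5:
  fixes k :: nat
  assumes "k \<ge> 1"
  shows "\<exists>(G :: (nat, nat) multigraph) F.
           r_graph (2 * k + 1) G \<and> perfect_matching G F \<and>
           (\<forall>Fs :: nat \<Rightarrow> nat set.
              (\<forall>i \<in> {1..2 * k}. perfect_matching G (Fs i)) \<longrightarrow>
              (\<exists>i j. 1 \<le> i \<and> i < j \<and> j \<le> 2 * k \<and> F \<inter> Fs i \<inter> Fs j \<noteq> {}))"
proof -
  let ?P = "expanded_petersen (2 * k + 1)"
  have wf: "wf_multigraph ?P"
    using wf_expanded assms by simp
  obtain f :: "nat \<times> nat \<Rightarrow> nat" where f: "inj_on f (mverts ?P)"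
    using finite_imp_inj_to_nat_seg wf unfolding wf_multigraph_def by metis
  obtain g :: "(nat \<times> nat) set \<Rightarrow> nat" where g: "inj_on g (medges ?P)"
    using finite_imp_inj_to_nat_seg wf unfolding wf_multigraph_def by metis
  let ?F = "mate_edges (2 * k + 1)"
  have F: "perfect_matching (relabel f g ?P) (g ` ?F)"
    using perfect_matching_relabel_iff[OF wf f g] perfect_matching_mate_edges
    by (simp add: medges_expanded)
  have "\<exists>i j. 1 \<le> i \<and> i < j \<and> j \<le> 2 * k \<and> g ` ?F \<inter> Fs i \<inter> Fs j \<noteq> {}"
    if Fs: "\<forall>i \<in> {1..2 * k}. perfect_matching (relabel f g ?P) (Fs i)" for Fs
  proof -
    \<comment> \<open>Each given matching is pulled back along \<open>g\<close> to the expanded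
      graph.\<close>
    have "\<exists>M. M \<subseteq> medges ?P \<and> Fs i = g ` M" if "i \<in> {1..2 * k}" for i
      using Fs that by (auto simp: perfect_matching_def subset_image_iff)
    then obtain Ms where Ms: "\<And>i. i \<in> {1..2 * k} \<Longrightarrow> Ms i \<subseteq> medges ?P \<and> Fs i = g ` Ms i"
      by metis
    then have "perfect_matching ?P (Ms i)" if "i \<in> {1..2 * k}" for i
      using Fs perfect_matching_relabel_iff[OF wf f g] that by metis
    then obtain i j where ij: "1 \<le> i" "i < j" "j \<le> 2 * k" "?F \<inter> Ms i \<inter> Ms j \<noteq> {}"
      using mate_edges_meet[OF assms] by meson
    then have "g ` ?F \<inter> Fs i \<inter> Fs j \<noteq> {}"
      using Ms[of i] Ms[of j] by auto
    then show ?thesis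
      using ij by blast
  qed
  moreover have "r_graph (2 * k + 1) (relabel f g ?P)"
    using r_graph_relabel[OF wf f g] r_graph_expanded assms by simp
  ultimately show ?thesis
    using F by blast
qed

end
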